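(* Let $1\le k\le n-1$, $\alpha,\beta\in\mathbb{C}$, $C\in\mathbb{C}^{(n-k)\times k}$, $D\in\mathbb{C}^{k\times(n-k)}$, and $$A=\begin{bmatrix}\alpha I_{n-k} & C\\ D & \beta I_k\end{bmatrix},\qquad H=C^*C+DD^*,\qquad Z=DC.$$ Suppose that, for some subspace $L$ of $\mathbb{C}^k$ invariant under $H$, the range of $Z$ is contained in $L$, which in turn is contained in the kernel of $Z$. Then the numerical range $W(A)$ is an elliptical disk centered at $(\alpha+\beta)/2$ with major axis parallel to $e^{-i\phi}$ of length $\sqrt{\mu+4|\gamma|^2}$ and minor axis of length $\sqrt{\mu}$, where $\mu$ is the largest eigenvalue of $H-2\operatorname{Re}Z$, $\gamma=(\alpha-\beta)/2$, and $\phi$ is the (principal) argument of $i\gamma$.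
   Context: For $A\in\mathbb{C}^{n\times n}$ the numerical range is $W(A)=\{\langle Ax,x\rangle: x\in\mathbb{C}^n,\ \|x\|=1\}\subset\mathbb{C}$, with the standard inner product. For a square matrix $X$, $\operatorname{Re}X=\frac12(X+X^* )$.
   Formalization: The argument φ is taken of the conjugate of γ instead of iγ, so the major axis is parallel to γ; as printed the direction is false, e.g. for n=2, k=1, α=1, β=-1, C=1, D=0, where the major axis is horizontal but e^{-iφ}=-i. *)

theory Defs
  imports "HOL-Analysis.Analysis"
begin

definition cinner :: "complex ^ 'n \<Rightarrow> complex ^ 'n \<Rightarrow> complex" where
  "cinner x y = (\<Sum>i\<in>UNIV. x $ i * cnj (y $ i))"

definition conj_transpose :: "complex ^ 'n ^ 'm \<Rightarrow> complex ^ 'm ^ 'n" where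
  "conj_transpose X = map_matrix cnj (transpose X)"

definition re_part :: "complex ^ 'n ^ 'n \<Rightarrow> complex ^ 'n ^ 'n" where
  "re_part X = (1/2) *\<^sub>R (X + conj_transpose X)"

definition numerical_range :: "complex ^ 'n ^ 'n \<Rightarrow> complex set" where
  "numerical_range X = {cinner (X *v x) x | x. norm x = 1}"

definition matrix_eigenvalue :: "complex ^ 'n ^ 'n \<Rightarrow> complex \<Rightarrow> bool" where
  "matrix_eigenvalue X c \<longleftrightarrow> (\<exists>v. v \<noteq> 0 \<and> X *v v = c *s v)"

text \<open>Only meaningful for matrices with a real eigenvalue, in particular Hermitian ones.\<close>

definition largest_eigenvalue :: "complex ^ 'n ^ 'n \<Rightarrow> real" where
  "largest_eigenvalue X = Max {r. matrix_eigenvalue X (complex_of_real r)}"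

text \<open>The blocks are \<open>P\<close>, \<open>Q\<close> in the first row and \<open>R\<close>, \<open>S\<close> in the second; the disjoint sum
  of the two index types indexes the rows and columns of the whole matrix.\<close>

definition block_matrix ::
  "'a ^ 'm ^ 'm \<Rightarrow> 'a ^ 'k ^ 'm \<Rightarrow> 'a ^ 'm ^ 'k \<Rightarrow> 'a ^ 'k ^ 'k \<Rightarrow> 'a ^ ('m + 'k) ^ ('m + 'k)" where
  "block_matrix P Q R S = (\<chi> i j.
     case i of
       Inl a \<Rightarrow> (case j of Inl b \<Rightarrow> P $ a $ b | Inr d \<Rightarrow> Q $ a $ d)
     | Inr c \<Rightarrow> (case j of Inl b \<Rightarrow> R $ c $ b | Inr d \<Rightarrow> S $ c $ d))"

text \<open>\<open>is_elliptical_disk S c u p q\<close>: \<open>S\<close> is the closed elliptical disk with center \<open>c\<close>, major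
  axis of (full) length \<open>p\<close> parallel to the unit complex number \<open>u\<close>, and minor axis of (full)
  length \<open>q\<close>. Degenerate disks are included: a segment if \<open>q = 0\<close>, a point if also \<open>p = 0\<close>;
  if \<open>p = q\<close> the choice of \<open>u\<close> is immaterial.\<close>

definition is_elliptical_disk ::
  "complex set \<Rightarrow> complex \<Rightarrow> complex \<Rightarrow> real \<Rightarrow> real \<Rightarrow> bool" where
  "is_elliptical_disk S c u p q \<longleftrightarrow> norm u = 1 \<and> 0 \<le> q \<and> q \<le> p \<and>
     S = {c + u * Complex (p / 2 * x) (q / 2 * y) | x y. x\<^sup>2 + y\<^sup>2 \<le> 1}"

text \<open>Direction of the major axis. The ellipse has foci \<open>\<alpha>\<close> and \<open>\<beta>\<close>, so its major axis is
  parallel to \<open>\<gamma> = (\<alpha> - \<beta>) / 2\<close>, that is, to \<open>cis (- \<phi>)\<close> with \<open>\<phi> = Arg (cnj \<gamma>)\<close>. The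
  source prints the argument of \<open>\<i> * \<gamma>\<close> instead of that of \<open>cnj \<gamma>\<close>, which is incorrect: for
  \<open>\<alpha> = 1\<close>, \<open>\<beta> = -1\<close>, \<open>C = 1\<close>, \<open>D = 0\<close> with one-by-one blocks the major axis is real, whereas
  \<open>cis (- Arg \<i>) = - \<i>\<close>.\<close>

end

theory Submission
  imports Defs
begin

text \<open>For a unit vector with components \<open>p\<close>, \<open>q\<close>, the value of the quadratic form of \<open>A\<close>, relative to
  the center, is \<open>\<gamma> (|p|\<^sup>2 - |q|\<^sup>2) + F p q\<close> with \<open>F p q = \<langle>C q, p\<rangle> + \<langle>D p, q\<rangle>\<close>. Now
  \<open>Re (\<omega> F p q) = Re \<langle>(\<omega> C + cnj \<omega> D\<^sup>*) q, p\<rangle>\<close>, and the hypothesis on \<open>L\<close> makes the norm of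
  \<open>\<omega> C + cnj \<omega> D\<^sup>*\<close> independent of the phase \<open>\<omega>\<close>; at \<open>\<omega> = \<i>\<close> its square is the largest eigenvalue
  \<open>\<mu>\<close> of \<open>H - 2 Re Z = (C - D\<^sup>*)\<^sup>* (C - D\<^sup>*)\<close>. So \<open>F\<close> maps pairs of unit vectors into the disk of
  radius \<open>sqrt \<mu>\<close> and hits every point of its boundary circle, and the numerical range is the
  image of the unit sphere under \<open>(s, z) \<mapsto> \<gamma> s + sqrt \<mu> z / 2\<close>, which is the elliptical disk.\<close>

section \<open>The complex inner product, its norm and adjoints\<close>

lemma inner_eq_Re_cinner: "x \<bullet> y = Re (cinner x y)"
  by (simp add: inner_vec_def cinner_def inner_complex_def)

lemma cinner_cnj: "cinner y x = cnj (cinner x y)"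
  by (simp add: cinner_def mult.commute)

lemma cinner_self: "cinner x x = of_real ((norm x)\<^sup>2)"
  by (simp add: cinner_def norm_vec_def L2_set_def sum_nonneg complex_norm_square
      del: of_real_power)

lemma cinner_add_left: "cinner (x + y) z = cinner x z + cinner y z"
  by (simp add: cinner_def distrib_right sum.distrib)

lemma cinner_add_right: "cinner z (x + y) = cinner z x + cinner z y"
  by (simp add: cinner_def distrib_left sum.distrib)

lemma cinner_scale_left: "cinner (c *s x) z = c * cinner x z"
  by (simp add: cinner_def sum_distrib_left mult.assoc)

lemma cinner_scale_right: "cinner z (c *s x) = cnj c * cinner z x"
  by (simp add: cinner_def sum_distrib_left mult_ac)

lemma norm_scale: "norm (c *s x) = cmod c * norm x" for x :: "complex ^ 'n"
proof -
  have "complex_of_real ((norm (c *s x))\<^sup>2) = of_real ((cmod c * norm x)\<^sup>2)"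
    unfolding cinner_self[symmetric] cinner_scale_left cinner_scale_right
    by (simp add: cinner_self power_mult_distrib complex_norm_square mult_ac del: of_real_power)
  then show ?thesis
    by (metis of_real_eq_iff mult_nonneg_nonneg norm_ge_zero power2_eq_imp_eq)
qed

lemma norm_add_sq: "(norm (x + y))\<^sup>2 = (norm x)\<^sup>2 + (norm y)\<^sup>2 + 2 * Re (cinner x y)"
  for x y :: "complex ^ 'n"
  by (simp add: power2_norm_eq_inner inner_simps inner_commute inner_eq_Re_cinner[symmetric])

lemma cinner_adjoint: "cinner (X *v x) y = cinner x (conj_transpose X *v y)"
proof -
  have "cinner (X *v x) y = (\<Sum>i\<in>UNIV. \<Sum>j\<in>UNIV. X $ i $ j * x $ j * cnj (y $ i))"
    by (simp add: cinner_def matrix_vector_mult_def sum_distrib_right)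
  also have "\<dots> = (\<Sum>j\<in>UNIV. \<Sum>i\<in>UNIV. X $ i $ j * x $ j * cnj (y $ i))"
    by (rule sum.swap)
  also have "\<dots> = cinner x (conj_transpose X *v y)"
    by (simp add: cinner_def matrix_vector_mult_def sum_distrib_left conj_transpose_def
        map_matrix_def transpose_def mult_ac)
  finally show ?thesis .
qed

lemma conj_transpose_conj_transpose [simp]: "conj_transpose (conj_transpose X) = X"
  by (simp add: conj_transpose_def map_matrix_def transpose_def vec_eq_iff)

lemma cinner_adjoint': "cinner (conj_transpose X *v x) y = cinner x (X *v y)"
  by (simp add: cinner_adjoint)

section \<open>Gram matrices and their largest eigenvalue\<close>

lemma inner_gram: "((conj_transpose K ** K) *v x) \<bullet> y = (K *v x) \<bullet> (K *v y)"
  by (simp add: inner_eq_Re_cinner cinner_adjoint' flip: matrix_vector_mul_assoc)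

lemma of_real_scale: "complex_of_real r *s x = r *\<^sub>R x"
  by (simp add: vec_eq_iff scaleR_conv_of_real[where 'a = complex])

lemma matrix_vector_mult_scaleR_complex: "K *v (r *\<^sub>R x) = r *\<^sub>R (K *v x)"
  for K :: "complex ^ 'n ^ 'm"
  by (simp add: vec.scale flip: of_real_scale)

lemma norm_add_scaleR_sq:
  "(norm (x + t *\<^sub>R y))\<^sup>2 = (norm x)\<^sup>2 + 2 * t * (x \<bullet> y) + t\<^sup>2 * (norm y)\<^sup>2"
  for x y :: "'a::real_inner"
  unfolding power2_norm_eq_inner
  by (simp add: inner_simps inner_commute power2_eq_square algebra_simps)

text \<open>A Gram matrix is symmetric for the real inner product, so eigenvectors of distinct real
  eigenvalues are orthogonal, and pairwise orthogonal sets are finite. This makes the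
  \<open>Max\<close> in \<open>largest_eigenvalue\<close> a true maximum.\<close>

lemma finite_real_eigenvalues_gram:
  "finite {r. matrix_eigenvalue (conj_transpose K ** K) (complex_of_real r)}" (is "finite ?S")
proof -
  let ?M = "conj_transpose K ** K"
  have "\<forall>r\<in>?S. \<exists>v. v \<noteq> 0 \<and> ?M *v v = r *\<^sub>R v"
    by (auto simp: matrix_eigenvalue_def of_real_scale)
  then obtain g where g: "\<And>r. r \<in> ?S \<Longrightarrow> g r \<noteq> 0 \<and> ?M *v g r = r *\<^sub>R g r"
    by metis
  have orth: "g r \<bullet> g s = 0" if "r \<in> ?S" "s \<in> ?S" "r \<noteq> s" for r s
  proof -
    have "r * (g r \<bullet> g s) = (?M *v g r) \<bullet> g s" "s * (g r \<bullet> g s) = (?M *v g s) \<bullet> g r"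
      using g[OF that(1)] g[OF that(2)] by (simp_all add: inner_commute)
    moreover have "(?M *v g r) \<bullet> g s = (?M *v g s) \<bullet> g r"
      by (metis inner_gram inner_commute)
    ultimately have "r * (g r \<bullet> g s) = s * (g r \<bullet> g s)" by simp
    with that show ?thesis by simp
  qed
  have "inj_on g ?S"
    by (rule inj_onI) (metis g orth inner_eq_zero_iff)
  moreover have "pairwise orthogonal (g ` ?S)"
    using orth unfolding pairwise_def orthogonal_def by blast
  then have "finite (g ` ?S)"
    by (rule pairwise_orthogonal_imp_finite)
  ultimately show ?thesis
    using finite_imageD by blast
qed

text \<open>The form \<open>\<nu> |x|^2 - |K x|^2\<close> is nonnegative and vanishes at
  \<open>v\<close>, so its first variation there is zero. The direction tested is \<open>w\<close>,
  the residual of the eigenvalue equation.\<close>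

lemma gram_maximizer_eigenvector:
  fixes K :: "complex ^ 'k ^ 'm"
  assumes bound: "\<And>w. (norm (K *v w))\<^sup>2 \<le> \<nu> * (norm w)\<^sup>2"
    and v: "(norm (K *v v))\<^sup>2 = \<nu> * (norm v)\<^sup>2"
  shows "(conj_transpose K ** K) *v v = \<nu> *\<^sub>R v"
proof -
  define w where "w = \<nu> *\<^sub>R v - (conj_transpose K ** K) *v v"
  define f where "f = \<nu> * (norm w)\<^sup>2 - (norm (K *v w))\<^sup>2"
  have f0: "f \<ge> 0" using bound by (simp add: f_def)
  have *: "0 \<le> 2 * t * (w \<bullet> w) + t\<^sup>2 * f" for t
  proof -
    have "\<nu> * (norm (v + t *\<^sub>R w))\<^sup>2 - (norm (K *v (v + t *\<^sub>R w)))\<^sup>2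
        = 2 * t * ((\<nu> *\<^sub>R v - (conj_transpose K ** K) *v v) \<bullet> w) + t\<^sup>2 * f"
      using v unfolding f_def matrix_vector_right_distrib matrix_vector_mult_scaleR_complex
        norm_add_scaleR_sq inner_diff_left inner_gram inner_scaleR_left
      by (simp add: algebra_simps)
    then show ?thesis
      using bound[of "v + t *\<^sub>R w"] by (simp add: w_def)
  qed
  have "w \<bullet> w = 0"
  proof (rule ccontr)
    assume "w \<bullet> w \<noteq> 0"
    then have "w \<bullet> w > 0" by simp
    \<comment> \<open>A small negative \<open>t\<close> lets the linear term win: here
      \<open>t\<^sup>2 * f\<close> is at most half the size of
      \<open>2 * t * (w \<bullet> w)\<close>. The added 1 keeps the denominator positive when
      \<open>f = 0\<close>.\<close>
    define t where "t = - (w \<bullet> w) / (f + 1)"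
    have "t\<^sup>2 * f = - t * (w \<bullet> w) * (f / (f + 1))"
      using f0 by (simp add: t_def power2_eq_square)
    also have "\<dots> \<le> - t * (w \<bullet> w) * 1"
      using f0 by (intro mult_left_mono) (auto simp: t_def)
    finally have "0 \<le> t * (w \<bullet> w)" using *[of t] by simp
    moreover have "t < 0" using f0 \<open>w \<bullet> w > 0\<close> by (simp add: t_def divide_neg_pos)
    ultimately show False using \<open>w \<bullet> w > 0\<close> by (simp add: zero_le_mult_iff)
  qed
  then show ?thesis by (simp add: w_def)
qed

text \<open>By compactness \<open>|K v|\<close> attains its maximum on the unit sphere, and a
  maximizer is an eigenvector. Conversely, each real eigenvalue is the Rayleigh quotient
  \<open>|K y|^2 / |y|^2\<close> of its eigenvector, hence no larger.\<close>

lemma largest_eigenvalue_gram: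
  fixes K :: "complex ^ 'k ^ 'm"
  defines "\<mu> \<equiv> largest_eigenvalue (conj_transpose K ** K)"
  shows "(norm (K *v w))\<^sup>2 \<le> \<mu> * (norm w)\<^sup>2"
    and "\<exists>v. norm v = 1 \<and> (norm (K *v v))\<^sup>2 = \<mu>"
proof -
  let ?M = "conj_transpose K ** K"
  have "bounded_linear ((*v) K)"
    by (intro linear_conv_bounded_linear[THEN iffD1] linearI)
      (simp_all add: matrix_vector_right_distrib matrix_vector_mult_scaleR_complex)
  then have "continuous_on (sphere 0 1) (\<lambda>v. (norm (K *v v))\<^sup>2)"
    by (intro continuous_intros linear_continuous_on)
  moreover have "sphere 0 1 \<noteq> ({} :: (complex ^ 'k) set)" by simp
  ultimately obtain v where v: "norm v = 1"
    and vmax: "\<And>y. norm y = 1 \<Longrightarrow> (norm (K *v y))\<^sup>2 \<le> (norm (K *v v))\<^sup>2"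
    using continuous_attains_sup[of "sphere 0 1" "\<lambda>v. (norm (K *v v))\<^sup>2"] by auto
  define \<nu> where "\<nu> = (norm (K *v v))\<^sup>2"
  have bound: "(norm (K *v w))\<^sup>2 \<le> \<nu> * (norm w)\<^sup>2" for w
  proof (cases "w = 0")
    case False
    have "(norm (K *v (inverse (norm w) *\<^sub>R w)))\<^sup>2 \<le> \<nu>"
      unfolding \<nu>_def using False by (intro vmax) simp
    then show ?thesis
      using False by (simp add: matrix_vector_mult_scaleR_complex power_mult_distrib field_simps)
  qed simp
  have "?M *v v = \<nu> *\<^sub>R v"
    using gram_maximizer_eigenvector[OF bound] v by (simp add: \<nu>_def)
  then have "matrix_eigenvalue ?M (of_real \<nu>)"
    unfolding matrix_eigenvalue_def of_real_scale using v by (intro exI[of _ v]) auto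
  moreover have "r \<le> \<nu>" if r: "matrix_eigenvalue ?M (of_real r)" for r
  proof -
    from r obtain y where y: "y \<noteq> 0" "?M *v y = r *\<^sub>R y"
      by (auto simp: matrix_eigenvalue_def of_real_scale)
    have "(norm (K *v y))\<^sup>2 = (?M *v y) \<bullet> y"
      by (simp only: inner_gram power2_norm_eq_inner)
    also have "\<dots> = r * (norm y)\<^sup>2"
      by (simp add: y power2_norm_eq_inner)
    finally show ?thesis using bound[of y] y by simp
  qed
  ultimately have "\<mu> = \<nu>"
    unfolding \<mu>_def largest_eigenvalue_def
    by (intro Max_eqI finite_real_eigenvalues_gram) auto
  then show "(norm (K *v w))\<^sup>2 \<le> \<mu> * (norm w)\<^sup>2"
    and "\<exists>v. norm v = 1 \<and> (norm (K *v v))\<^sup>2 = \<mu>"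
    using bound v \<nu>_def by auto
qed

section \<open>Orthogonal splitting along \<open>L\<close> and the phase twist\<close>

text \<open>The real orthogonal decomposition is already the complex one: \<open>L\<close> is closed
  under multiplication by \<open>\<i>\<close>, and testing against \<open>\<i> *s y\<close> controls
  the imaginary part of \<open>cinner q2 y\<close>.\<close>

lemma complex_orthogonal_decomposition:
  fixes L :: "(complex ^ 'k) set"
  assumes L: "vec.subspace L"
  obtains q1 q2 where "q = q1 + q2" "q1 \<in> L" "\<And>y. y \<in> L \<Longrightarrow> cinner q2 y = 0"
proof -
  have "subspace L"
    using L by (auto simp: vec.subspace_def subspace_def simp flip: of_real_scale)
  then have span: "span L = L" by (simp add: span_eq_iff)
  obtain q1 q2 where q: "q1 \<in> L" "\<And>w. w \<in> L \<Longrightarrow> orthogonal q2 w" "q = q1 + q2"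
    using orthogonal_subspace_decomp_exists[of L q] span by metis
  have "cinner q2 y = 0" if "y \<in> L" for y
  proof -
    have "\<i> *s y \<in> L" using L that by (simp add: vec.subspace_def)
    then have "Re (cinner q2 (\<i> *s y)) = 0" "Re (cinner q2 y) = 0"
      using q(2) that by (simp_all add: orthogonal_def inner_eq_Re_cinner)
    then show ?thesis by (simp add: cinner_scale_right complex_eq_iff)
  qed
  with q that show thesis by blast
qed

text \<open>On \<open>L \<oplus> L\<^sup>\<bottom>\<close> the operator \<open>H\<close> is block diagonal while \<open>Z\<close> only maps \<open>L\<^sup>\<bottom>\<close> to \<open>L\<close>;
  hence the unitary \<open>\<tau> \<oplus> 1\<close> commutes with \<open>H\<close> and multiplies \<open>Z\<close> by a phase.\<close>

lemma twist_forms: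
  fixes H Z :: "complex ^ 'k ^ 'k"
  assumes L: "vec.subspace L" and HL: "\<forall>x\<in>L. H *v x \<in> L"
    and hermitian: "conj_transpose H = H"
    and ran: "range (\<lambda>x. Z *v x) \<subseteq> L" and ker: "L \<subseteq> {x. Z *v x = 0}"
    and q1: "q1 \<in> L" and q2: "\<And>y. y \<in> L \<Longrightarrow> cinner q2 y = 0"
    and \<tau>: "cmod \<tau> = 1"
  shows "cinner (H *v (\<tau> *s q1 + q2)) (\<tau> *s q1 + q2) = cinner (H *v (q1 + q2)) (q1 + q2)"
    and "cinner (Z *v (\<tau> *s q1 + q2)) (\<tau> *s q1 + q2) = cnj \<tau> * cinner (Z *v (q1 + q2)) (q1 + q2)"
    and "norm (\<tau> *s q1 + q2) = norm (q1 + q2)"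
proof -
  have q2': "cinner y q2 = 0" if "y \<in> L" for y
    using q2[OF that] cinner_cnj[of y q2] by simp
  have \<tau>\<tau>: "\<tau> * cnj \<tau> = 1" "cnj \<tau> * \<tau> = 1"
    using \<tau> complex_norm_square[of \<tau>] by (simp_all add: mult.commute)
  have "H *v q1 \<in> L" using HL q1 by blast
  then have H: "cinner (H *v q1) q2 = 0" "cinner (H *v q2) q1 = 0"
    using q2 q2' by (simp_all add: cinner_adjoint[of H q2] hermitian)
  show "cinner (H *v (\<tau> *s q1 + q2)) (\<tau> *s q1 + q2) = cinner (H *v (q1 + q2)) (q1 + q2)"
    by (simp add: matrix_vector_right_distrib vec.scale cinner_add_left cinner_add_right
        cinner_scale_left cinner_scale_right H \<tau>\<tau>
        flip: mult.assoc)
  have "Z *v q1 = 0" "Z *v q2 \<in> L" using ker ran q1 by auto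
  then show "cinner (Z *v (\<tau> *s q1 + q2)) (\<tau> *s q1 + q2)
      = cnj \<tau> * cinner (Z *v (q1 + q2)) (q1 + q2)"
    by (simp add: matrix_vector_right_distrib vec.scale cinner_add_right cinner_scale_right q2')
  have "(norm (\<tau> *s q1 + q2))\<^sup>2 = (norm (q1 + q2))\<^sup>2"
    using q1 by (simp add: norm_add_sq norm_scale \<tau> cinner_scale_left q2')
  then show "norm (\<tau> *s q1 + q2) = norm (q1 + q2)"
    by (simp add: power2_eq_iff_nonneg)
qed

section \<open>The norm of \<open>\<omega> C + cnj \<omega> D\<^sup>*\<close> and its dependence on
  the phase\<close>

text \<open>The phase enters only through the cross term, where
  \<open><C q, D\<^sup>* q> = <D C q, q>\<close>.\<close>

lemma norm_combination_sq:
  fixes C :: "complex ^ 'k ^ 'm" and D :: "complex ^ 'm ^ 'k"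
  assumes "cmod \<omega> = 1"
  shows "(norm (\<omega> *s (C *v q) + cnj \<omega> *s (conj_transpose D *v q)))\<^sup>2
    = Re (cinner ((conj_transpose C ** C + D ** conj_transpose D) *v q) q)
      + 2 * Re (\<omega>\<^sup>2 * cinner ((D ** C) *v q) q)"
proof -
  have "cinner ((conj_transpose C ** C + D ** conj_transpose D) *v q) q
      = of_real ((norm (C *v q))\<^sup>2 + (norm (conj_transpose D *v q))\<^sup>2)"
    by (simp add: matrix_vector_mult_add_rdistrib cinner_add_left cinner_adjoint cinner_self
        flip: matrix_vector_mul_assoc)
  moreover have "cinner ((D ** C) *v q) q = cinner (C *v q) (conj_transpose D *v q)"
    by (simp add: cinner_adjoint[of D] flip: matrix_vector_mul_assoc)
  ultimately show ?thesis
    unfolding norm_add_sq norm_scale cinner_scale_left cinner_scale_right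
    using assms by (simp add: power2_eq_square[of \<omega>] mult.assoc)
qed

lemma conj_transpose_gram_sum:
  "conj_transpose (conj_transpose C ** C + D ** conj_transpose D)
    = conj_transpose C ** C + D ** conj_transpose D"
  by (simp add: conj_transpose_def map_matrix_def transpose_def vec_eq_iff matrix_matrix_mult_def
      mult.commute)

text \<open>Recognizing a Gram matrix here turns its largest eigenvalue \<mu> into the squared
  operator norm of \<open>C - conj_transpose D\<close>.\<close>

lemma gram_difference:
  "conj_transpose C ** C + D ** conj_transpose D - 2 *\<^sub>R re_part (D ** C)
    = conj_transpose (C - conj_transpose D) ** (C - conj_transpose D)"
  by (simp add: re_part_def conj_transpose_def map_matrix_def transpose_def vec_eq_iff
      matrix_matrix_mult_def algebra_simps sum.distrib sum_subtractf)

text \<open>The twist preserves the form of \<open>H\<close> and multiplies that of \<open>Z\<close>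
  by \<open>cnj \<tau> = - \<omega>\<^sup>2\<close>. As \<open>\<i>\<^sup>2 = -1\<close>, phase \<i>
  at the twisted vector gives the same norm as phase \<omega> at the original one.\<close>

lemma twisted_norm:
  fixes C :: "complex ^ 'k ^ 'm" and D :: "complex ^ 'm ^ 'k"
  defines "H \<equiv> conj_transpose C ** C + D ** conj_transpose D"
  assumes L: "vec.subspace L" "\<forall>x\<in>L. H *v x \<in> L"
      "range (\<lambda>x. (D ** C) *v x) \<subseteq> L" "L \<subseteq> {x. (D ** C) *v x = 0}"
    and q: "q1 \<in> L" "\<And>y. y \<in> L \<Longrightarrow> cinner q2 y = 0"
    and \<omega>: "cmod \<omega> = 1" and \<tau>: "\<tau> = - cnj (\<omega>\<^sup>2)"
  shows "norm (\<omega> *s (C *v (q1 + q2)) + cnj \<omega> *s (conj_transpose D *v (q1 + q2)))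
    = norm ((C - conj_transpose D) *v (\<tau> *s q1 + q2))"
proof -
  let ?q = "\<tau> *s q1 + q2"
  have \<tau>1: "cmod \<tau> = 1" using \<omega> by (simp add: \<tau> norm_power)
  note tw = twist_forms[OF L(1,2) _ L(3,4) q \<tau>1]
  have "(norm (\<omega> *s (C *v (q1 + q2)) + cnj \<omega> *s (conj_transpose D *v (q1 + q2))))\<^sup>2
      = (norm (\<i> *s (C *v ?q) + cnj \<i> *s (conj_transpose D *v ?q)))\<^sup>2"
    unfolding norm_combination_sq[OF \<omega>] norm_combination_sq[of \<i>, OF norm_ii]
    using tw(1,2) conj_transpose_gram_sum[of C D] by (simp add: H_def \<tau>)
  also have "\<i> *s (C *v ?q) + cnj \<i> *s (conj_transpose D *v ?q)
      = \<i> *s ((C - conj_transpose D) *v ?q)"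
    by (simp add: matrix_vector_mult_diff_rdistrib vec_eq_iff right_diff_distrib)
  finally show ?thesis
    unfolding norm_scale by (simp add: power2_eq_iff_nonneg)
qed

section \<open>The off-diagonal form \<open>F\<close>\<close>

text \<open>Conjugating the second term keeps its real part and turns the factor \<omega> into
  \<open>cnj \<omega>\<close>. Both terms become pairings with the same \<open>p\<close>, ready for
  Cauchy-Schwarz.\<close>

lemma offdiagonal_Re:
  fixes C :: "complex ^ 'k ^ 'm" and D :: "complex ^ 'm ^ 'k"
  shows "Re (\<omega> * (cinner (C *v q) p + cinner (D *v p) q))
    = (\<omega> *s (C *v q) + cnj \<omega> *s (conj_transpose D *v q)) \<bullet> p"
proof -
  have "cinner (D *v p) q = cnj (cinner (conj_transpose D *v q) p)"
    by (metis cinner_adjoint cinner_cnj)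
  then show ?thesis
    by (simp add: inner_eq_Re_cinner cinner_add_left cinner_scale_left distrib_left)
qed

lemma offdiagonal_range:
  fixes C :: "complex ^ 'k ^ 'm" and D :: "complex ^ 'm ^ 'k"
  defines "H \<equiv> conj_transpose C ** C + D ** conj_transpose D"
  defines "\<mu> \<equiv> largest_eigenvalue (H - 2 *\<^sub>R re_part (D ** C))"
  defines "F \<equiv> \<lambda>p q. cinner (C *v q) p + cinner (D *v p) q"
  assumes L: "vec.subspace L" "\<forall>x\<in>L. H *v x \<in> L"
      "range (\<lambda>x. (D ** C) *v x) \<subseteq> L" "L \<subseteq> {x. (D ** C) *v x = 0}"
  shows "0 \<le> \<mu>"
    and "cmod (F p q) \<le> sqrt \<mu> * norm p * norm q"
    and "cmod z = 1 \<Longrightarrow> \<exists>p q. norm p = 1 \<and> norm q = 1 \<and> F p q = of_real (sqrt \<mu>) * z"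
proof -
  let ?K = "C - conj_transpose D"
  have \<mu>_gram: "\<mu> = largest_eigenvalue (conj_transpose ?K ** ?K)"
    by (simp add: \<mu>_def H_def gram_difference)
  note le = largest_eigenvalue_gram(1)[of ?K, folded \<mu>_gram]
  obtain v where v: "norm v = 1" "(norm (?K *v v))\<^sup>2 = \<mu>"
    using largest_eigenvalue_gram(2)[of ?K, folded \<mu>_gram] by blast
  then show \<mu>0: "0 \<le> \<mu>" by (metis zero_le_power2)
  let ?T = "\<lambda>\<omega> q. \<omega> *s (C *v q) + cnj \<omega> *s (conj_transpose D *v q)"
  note tn = twisted_norm[OF L[unfolded H_def]]
  note tw = twist_forms[OF L(1,2) _ L(3,4)]
  have herm: "conj_transpose H = H" by (simp add: H_def conj_transpose_gram_sum)
  have T_le: "norm (?T \<omega> q) \<le> sqrt \<mu> * norm q" if "cmod \<omega> = 1" for \<omega> q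
  proof -
    obtain q1 q2 where q: "q = q1 + q2" "q1 \<in> L" "\<And>y. y \<in> L \<Longrightarrow> cinner q2 y = 0"
      using complex_orthogonal_decomposition[OF L(1)] by metis
    define \<tau> where "\<tau> = - cnj (\<omega>\<^sup>2)"
    have \<tau>: "cmod \<tau> = 1" using that by (simp add: \<tau>_def norm_power)
    have "norm (?T \<omega> q) = norm (?K *v (\<tau> *s q1 + q2))"
      unfolding q(1) by (rule tn[OF q(2,3) that \<tau>_def])
    also have "\<dots> \<le> sqrt (\<mu> * (norm (\<tau> *s q1 + q2))\<^sup>2)"
      by (intro real_le_rsqrt le)
    also have "\<dots> = sqrt \<mu> * norm q"
      using tw(3)[OF herm q(2,3) \<tau>] by (simp add: real_sqrt_mult q(1))
    finally show ?thesis .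
  qed
  show F_le: "cmod (F p q) \<le> sqrt \<mu> * norm p * norm q" for p q
  proof (cases "F p q = 0")
    case True
    then show ?thesis using \<mu>0 by simp
  next
    case False
    \<comment> \<open>Rotating by this phase makes \<open>F p q\<close> real and nonnegative, so its
      modulus is a real part.\<close>
    define \<omega> where "\<omega> = cnj (sgn (F p q))"
    have \<omega>: "cmod \<omega> = 1" using False by (simp add: \<omega>_def norm_sgn)
    have "\<omega> * F p q = cmod (F p q)"
      using False complex_norm_square[of "F p q"]
      by (simp add: \<omega>_def sgn_eq power2_eq_square field_simps)
    then have "cmod (F p q) = Re (\<omega> * F p q)" by simp
    also have "\<dots> = ?T \<omega> q \<bullet> p" unfolding F_def by (rule offdiagonal_Re)
    also have "\<dots> \<le> norm (?T \<omega> q) * norm p" by (rule norm_cauchy_schwarz)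
    also have "\<dots> \<le> sqrt \<mu> * norm q * norm p"
      by (intro mult_right_mono T_le[OF \<omega>]) simp
    finally show ?thesis by (simp add: mult_ac)
  qed
  assume z: "cmod z = 1"
  \<comment> \<open>With this phase the goal becomes
    \<open>\<omega> * F p q = sqrt \<mu>\<close>.\<close>
  define \<omega> where "\<omega> = cnj z"
  define \<tau> where "\<tau> = - cnj (\<omega>\<^sup>2)"
  have \<omega>: "cmod \<omega> = 1" "z * \<omega> = 1"
    using z complex_norm_square[of z] by (simp_all add: \<omega>_def)
  have \<tau>: "cmod \<tau> = 1" "\<tau> * cnj \<tau> = 1"
    using \<omega> complex_norm_square[of \<tau>] by (simp_all add: \<tau>_def norm_power)
  obtain v1 v2 where v12: "v = v1 + v2" "v1 \<in> L" "\<And>y. y \<in> L \<Longrightarrow> cinner v2 y = 0"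
    using complex_orthogonal_decomposition[OF L(1)] by metis
  \<comment> \<open>The inverse twist of the maximizer \<open>v\<close>: twisting by \<tau> restores
    \<open>v\<close>, so \<open>q\<close> attains the bound for phase \<omega>.\<close>
  define q where "q = cnj \<tau> *s v1 + v2"
  have v1L: "cnj \<tau> *s v1 \<in> L" using L(1) v12(2) by (simp add: vec.subspace_def)
  have q1: "norm q = 1"
    using tw(3)[OF herm v12(2,3), of "cnj \<tau>"] \<tau> v v12 by (simp add: q_def)
  have "norm (?T \<omega> q) = norm (?K *v (\<tau> *s (cnj \<tau> *s v1) + v2))"
    unfolding q_def by (rule tn[OF v1L v12(3) \<omega>(1) \<tau>_def])
  also have "\<tau> *s (cnj \<tau> *s v1) + v2 = v"
    by (simp add: \<tau>(2) v12(1))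
  also have "norm (?K *v v) = sqrt \<mu>"
    using v(2) by (metis norm_ge_zero real_sqrt_unique)
  finally have T: "norm (?T \<omega> q) = sqrt \<mu>" .
  \<comment> \<open>Equality in Cauchy-Schwarz: \<open>p\<close> is the direction of the vector
    paired with it. For \<open>\<mu> = 0\<close> that vector is zero and an arbitrary unit vector
    serves.\<close>
  obtain p where p: "norm p = 1" "?T \<omega> q \<bullet> p = sqrt \<mu>"
  proof (cases "\<mu> = 0")
    case True
    with T that[of "axis undefined 1"] show ?thesis by simp
  next
    case False
    then have "?T \<omega> q \<noteq> 0" using T by auto
    then have "?T \<omega> q \<bullet> sgn (?T \<omega> q) = norm (?T \<omega> q)"
      by (simp add: sgn_div_norm power2_norm_eq_inner[symmetric] power2_eq_square)
    with T \<open>?T \<omega> q \<noteq> 0\<close> that[of "sgn (?T \<omega> q)"] show ?thesis by (simp add: norm_sgn)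
  qed
  have Re: "Re (\<omega> * F p q) = sqrt \<mu>"
    unfolding F_def offdiagonal_Re by (rule p(2))
  \<comment> \<open>The modulus does not exceed the real part, which forces the imaginary part to
    vanish.\<close>
  have "cmod (\<omega> * F p q) \<le> sqrt \<mu>"
    using F_le[of p q] p(1) q1 \<omega> by (simp add: norm_mult)
  then have "(cmod (\<omega> * F p q))\<^sup>2 \<le> (sqrt \<mu>)\<^sup>2" by (intro power_mono) auto
  then have "(Im (\<omega> * F p q))\<^sup>2 \<le> 0"
    unfolding cmod_power2 Re by linarith
  then have "\<omega> * F p q = sqrt \<mu>"
    using Re by (intro complex_eqI) auto
  then have "F p q = of_real (sqrt \<mu>) * z"
    using \<omega>(2) by (metis mult.assoc mult.commute mult_1)
  with p q1 show "\<exists>p q. norm p = 1 \<and> norm q = 1 \<and> F p q = of_real (sqrt \<mu>) * z" by blast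
qed

section \<open>Block vectors and the numerical range in terms of \<open>F\<close>\<close>

definition join_vec :: "'a ^ 'm \<Rightarrow> 'a ^ 'k \<Rightarrow> 'a ^ ('m + 'k)" where
  "join_vec p q = (\<chi> i. case i of Inl a \<Rightarrow> p $ a | Inr b \<Rightarrow> q $ b)"

lemma join_vec_surj: "\<exists>p q. x = join_vec p q"
  by (rule exI[of _ "\<chi> a. x $ Inl a"], rule exI[of _ "\<chi> b. x $ Inr b"])
    (auto simp: join_vec_def vec_eq_iff split: sum.split)

lemma sum_UNIV_Plus:
  fixes f :: "'m::finite + 'k::finite \<Rightarrow> 'a::comm_monoid_add"
  shows "sum f UNIV = (\<Sum>a\<in>UNIV. f (Inl a)) + (\<Sum>b\<in>UNIV. f (Inr b))"
  by (simp add: sum.Plus flip: UNIV_Plus_UNIV)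

lemma cinner_join_vec: "cinner (join_vec p q) (join_vec p' q') = cinner p p' + cinner q q'"
  by (simp add: cinner_def sum_UNIV_Plus join_vec_def)

lemma norm_join_vec: "(norm (join_vec p q))\<^sup>2 = (norm p)\<^sup>2 + (norm q)\<^sup>2"
  for p :: "complex ^ 'm" and q :: "complex ^ 'k"
  using cinner_join_vec[of p q p q] by (simp only: cinner_self of_real_eq_iff flip: of_real_add)

lemma block_matrix_mult_join_vec:
  "block_matrix P Q R S *v join_vec p q = join_vec (P *v p + Q *v q) (R *v p + S *v q)"
  by (auto simp: vec_eq_iff matrix_vector_mult_def sum_UNIV_Plus join_vec_def block_matrix_def
      split: sum.split)

lemma mat_mult_vector: "mat c *v x = c *s x" for x :: "complex ^ 'n"
  by (simp add: mat_def matrix_vector_mult_def vec_eq_iff if_distrib[of "\<lambda>t. t * _"] cong: if_cong)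

lemma cinner_block_matrix:
  fixes p :: "complex ^ 'm" and q :: "complex ^ 'k"
  assumes "(norm p)\<^sup>2 + (norm q)\<^sup>2 = 1"
  shows "cinner (block_matrix (mat \<alpha>) C D (mat \<beta>) *v join_vec p q) (join_vec p q)
    = (\<alpha> + \<beta>) / 2 + (\<alpha> - \<beta>) / 2 * of_real ((norm p)\<^sup>2 - (norm q)\<^sup>2)
      + (cinner (C *v q) p + cinner (D *v p) q)"
proof -
  have p: "(norm p)\<^sup>2 = 1 - (norm q)\<^sup>2" using assms by simp
  show ?thesis
    unfolding block_matrix_mult_join_vec cinner_join_vec mat_mult_vector cinner_add_left
      cinner_scale_left cinner_self p
    by (simp add: field_simps)
qed

text \<open>The double-angle identity. For \<open>P\<close>, \<open>Q\<close> the norms of the two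
  components of a unit vector, it ties the diagonal coefficient \<open>P\<^sup>2 - Q\<^sup>2\<close>
  to the bound \<open>2 * P * Q\<close> on the off-diagonal part.\<close>

lemma unit_sphere_norms:
  fixes P Q :: real
  assumes "P\<^sup>2 + Q\<^sup>2 = 1"
  shows "(P\<^sup>2 - Q\<^sup>2)\<^sup>2 + (2 * P * Q)\<^sup>2 = 1"
proof -
  have "(P\<^sup>2 - Q\<^sup>2)\<^sup>2 + (2 * P * Q)\<^sup>2 = (P\<^sup>2 + Q\<^sup>2)\<^sup>2"
    by algebra
  with assms show ?thesis by simp
qed

lemma numerical_range_block_subset:
  fixes C :: "complex ^ 'k ^ 'm" and D :: "complex ^ 'm ^ 'k"
  defines "F \<equiv> \<lambda>p q. cinner (C *v q) p + cinner (D *v p) q"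
  assumes m: "0 \<le> m" and F: "\<And>p q. cmod (F p q) \<le> 2 * m * norm p * norm q"
  shows "numerical_range (block_matrix (mat \<alpha>) C D (mat \<beta>))
    \<subseteq> {(\<alpha> + \<beta>) / 2 + (\<alpha> - \<beta>) / 2 * of_real s + of_real m * z | s z. s\<^sup>2 + (cmod z)\<^sup>2 \<le> 1}"
proof
  fix w assume "w \<in> numerical_range (block_matrix (mat \<alpha>) C D (mat \<beta>))"
  then obtain x where x: "norm x = 1"
    and w: "w = cinner (block_matrix (mat \<alpha>) C D (mat \<beta>) *v x) x"
    by (auto simp: numerical_range_def)
  obtain p q where pq: "x = join_vec p q" using join_vec_surj by blast
  have 1: "(norm p)\<^sup>2 + (norm q)\<^sup>2 = 1"
    using x norm_join_vec[of p q] by (simp add: pq)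
  \<comment> \<open>For \<open>m = 0\<close> the quotient is 0 by convention, which is consistent
    because \<open>F p q\<close> then vanishes too.\<close>
  define z where "z = F p q / of_real m"
  have Fz: "F p q = of_real m * z"
    using F[of p q] by (cases "m = 0") (auto simp: z_def)
  have "cmod z \<le> 2 * norm p * norm q"
    using F[of p q] m by (cases "m = 0") (auto simp: z_def norm_divide field_simps)
  then have "(cmod z)\<^sup>2 \<le> (2 * norm p * norm q)\<^sup>2"
    by (intro power_mono) auto
  then have "((norm p)\<^sup>2 - (norm q)\<^sup>2)\<^sup>2 + (cmod z)\<^sup>2 \<le> 1"
    using unit_sphere_norms[OF 1] by linarith
  moreover have "w = (\<alpha> + \<beta>) / 2 + (\<alpha> - \<beta>) / 2 * of_real ((norm p)\<^sup>2 - (norm q)\<^sup>2) + of_real m * z"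
    unfolding w pq cinner_block_matrix[OF 1] Fz[symmetric] F_def ..
  ultimately show "w \<in> {(\<alpha> + \<beta>) / 2 + (\<alpha> - \<beta>) / 2 * of_real s + of_real m * z | s z.
      s\<^sup>2 + (cmod z)\<^sup>2 \<le> 1}"
    by blast
qed

text \<open>\<open>F\<close> is homogeneous under real scaling of each argument, so rescaling one
  extremal pair of unit vectors realizes every smaller modulus in the same direction.\<close>

lemma numerical_range_block_superset:
  fixes C :: "complex ^ 'k ^ 'm" and D :: "complex ^ 'm ^ 'k"
  defines "F \<equiv> \<lambda>p q. cinner (C *v q) p + cinner (D *v p) q"
  assumes F: "\<And>z. cmod z = 1 \<Longrightarrow> \<exists>p q. norm p = 1 \<and> norm q = 1 \<and> F p q = of_real (2 * m) * z"
    and sz: "s\<^sup>2 + (cmod z)\<^sup>2 = 1"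
  shows "(\<alpha> + \<beta>) / 2 + (\<alpha> - \<beta>) / 2 * of_real s + of_real m * z
    \<in> numerical_range (block_matrix (mat \<alpha>) C D (mat \<beta>))"
proof -
  \<comment> \<open>The direction of \<open>z\<close>; for \<open>z = 0\<close> any unit number
    would do.\<close>
  define e where "e = (if z = 0 then 1 else sgn z)"
  have e: "cmod e = 1" "of_real (cmod z) * e = z"
    by (simp_all add: e_def norm_sgn) (simp add: sgn_eq)
  obtain p q where pq: "norm p = 1" "norm q = 1" "F p q = of_real (2 * m) * e"
    using F[OF e(1)] by blast
  \<comment> \<open>\<open>P\<close> and \<open>Q\<close> solve
    \<open>P\<^sup>2 + Q\<^sup>2 = 1\<close> and \<open>P\<^sup>2 - Q\<^sup>2 = s\<close>; then
    \<open>2 * P * Q = cmod z\<close> because \<open>(s, z)\<close> lies on the unit sphere.\<close>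
  define P where "P = sqrt ((1 + s) / 2)"
  define Q where "Q = sqrt ((1 - s) / 2)"
  have s: "\<bar>s\<bar> \<le> 1"
    using sz by (metis abs_le_square_iff abs_one le_add_same_cancel1 one_power2 zero_le_power2)
  have PQ: "P \<ge> 0" "Q \<ge> 0" "P\<^sup>2 = (1 + s) / 2" "Q\<^sup>2 = (1 - s) / 2"
    using s by (auto simp: P_def Q_def)
  have "(2 * P * Q)\<^sup>2 = (cmod z)\<^sup>2"
    using sz unfolding power_mult_distrib PQ by (simp add: field_simps power2_eq_square)
  then have PQz: "2 * P * Q = cmod z"
    using PQ by (simp add: power2_eq_iff_nonneg)
  let ?x = "join_vec (of_real P *s p) (of_real Q *s q)"
  have n: "(norm (of_real P *s p))\<^sup>2 = P\<^sup>2" "(norm (of_real Q *s q))\<^sup>2 = Q\<^sup>2"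
    using pq PQ by (simp_all add: norm_scale)
  have 1: "(norm (of_real P *s p))\<^sup>2 + (norm (of_real Q *s q))\<^sup>2 = 1"
    unfolding n PQ by (simp add: field_simps)
  have "F (of_real P *s p) (of_real Q *s q) = of_real (P * Q) * F p q"
    by (simp add: F_def vec.scale cinner_scale_left cinner_scale_right algebra_simps)
  also have "\<dots> = of_real m * (of_real (2 * P * Q) * e)"
    by (simp add: pq(3))
  finally have "F (of_real P *s p) (of_real Q *s q) = of_real m * z"
    unfolding PQz e(2) .
  moreover have "P\<^sup>2 - Q\<^sup>2 = s" unfolding PQ by (simp add: field_simps)
  ultimately have "cinner (block_matrix (mat \<alpha>) C D (mat \<beta>) *v ?x) ?x
      = (\<alpha> + \<beta>) / 2 + (\<alpha> - \<beta>) / 2 * of_real s + of_real m * z"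
    unfolding cinner_block_matrix[OF 1] n F_def by simp
  moreover have "norm ?x = 1"
    using 1 norm_join_vec[of "of_real P *s p" "of_real Q *s q"]
    by (metis norm_ge_zero real_sqrt_one real_sqrt_unique)
  ultimately show ?thesis
    unfolding numerical_range_def mem_Collect_eq by metis
qed

section \<open>The ellipse as a linear image of the ball and of the sphere\<close>

text \<open>Polar coordinates of \<open>(g, m)\<close>, stated without division so that the origin,
  and with it degenerate ellipses, is covered.\<close>

lemma polar_pair:
  fixes g m :: real
  obtains a b where "g = sqrt (g\<^sup>2 + m\<^sup>2) * a" "m = sqrt (g\<^sup>2 + m\<^sup>2) * b" "a\<^sup>2 + b\<^sup>2 = 1"
proof (cases "g = 0 \<and> m = 0")
  case True
  then show ?thesis using that[of 1 0] by simp
next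
  case False
  then have pos: "g\<^sup>2 + m\<^sup>2 > 0" by (simp add: sum_power2_gt_zero_iff)
  with False have "(g / sqrt (g\<^sup>2 + m\<^sup>2))\<^sup>2 + (m / sqrt (g\<^sup>2 + m\<^sup>2))\<^sup>2 = 1"
    by (simp add: power_divide flip: add_divide_distrib)
  then show ?thesis
    using pos False
    by (intro that[of "g / sqrt (g\<^sup>2 + m\<^sup>2)" "m / sqrt (g\<^sup>2 + m\<^sup>2)"]) auto
qed

text \<open>After rotation by \<open>cnj u\<close>, the real part of the image is \<open>r\<close>
  times the component of \<open>(s, Re v)\<close> along the unit vector \<open>(a, b)\<close>, and
  projecting onto a direction does not increase length. The imaginary part is just
  \<open>m * Im v\<close>.\<close>

lemma ball_image_subset_ellipse:
  assumes u: "cmod u = 1" and sz: "s\<^sup>2 + (cmod z)\<^sup>2 \<le> 1"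
  shows "\<exists>x y. x\<^sup>2 + y\<^sup>2 \<le> 1 \<and>
    of_real g * u * of_real s + of_real m * z = u * Complex (sqrt (g\<^sup>2 + m\<^sup>2) * x) (m * y)"
proof -
  obtain a b where ab: "g = sqrt (g\<^sup>2 + m\<^sup>2) * a" "m = sqrt (g\<^sup>2 + m\<^sup>2) * b" "a\<^sup>2 + b\<^sup>2 = 1"
    by (rule polar_pair)
  define r where "r = sqrt (g\<^sup>2 + m\<^sup>2)"
  define v where "v = z * cnj u"
  have uu: "u * cnj u = 1" using u complex_norm_square[of u] by simp
  have zv: "z = u * v" unfolding v_def using uu by (metis mult.commute mult.left_commute mult_1)
  have v: "(cmod z)\<^sup>2 = (Re v)\<^sup>2 + (Im v)\<^sup>2"
    unfolding zv norm_mult u by (simp add: cmod_power2)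
  define x where "x = a * s + b * Re v"
  have "x\<^sup>2 + (a * Re v - b * s)\<^sup>2 = (a\<^sup>2 + b\<^sup>2) * (s\<^sup>2 + (Re v)\<^sup>2)"
    unfolding x_def by algebra
  then have "x\<^sup>2 \<le> s\<^sup>2 + (Re v)\<^sup>2" using ab(3) by (metis le_add_same_cancel1 mult_1 zero_le_power2)
  then have "x\<^sup>2 + (Im v)\<^sup>2 \<le> 1" using sz v by linarith
  moreover have "g * s + m * Re v = r * x"
    unfolding x_def using ab(1,2) unfolding r_def[symmetric] by algebra
  then have "of_real g * of_real s + of_real m * v = Complex (r * x) (m * Im v)"
    by (simp add: complex_eq_iff)
  then have "of_real g * u * of_real s + of_real m * z = u * Complex (r * x) (m * Im v)"
    unfolding zv by (metis (no_types, lifting) distrib_left mult.assoc mult.commute)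
  ultimately show ?thesis unfolding r_def by blast
qed

text \<open>The sphere suffices because a linear map from three to two dimensions maps it onto the
  image of the ball.\<close>

lemma ellipse_subset_sphere_image:
  assumes u: "cmod u = 1" and xy: "x\<^sup>2 + y\<^sup>2 \<le> 1"
  shows "\<exists>s z. s\<^sup>2 + (cmod z)\<^sup>2 = 1 \<and>
    of_real g * u * of_real s + of_real m * z = u * Complex (sqrt (g\<^sup>2 + m\<^sup>2) * x) (m * y)"
proof -
  obtain a b where ab: "g = sqrt (g\<^sup>2 + m\<^sup>2) * a" "m = sqrt (g\<^sup>2 + m\<^sup>2) * b" "a\<^sup>2 + b\<^sup>2 = 1"
    by (rule polar_pair)
  define r where "r = sqrt (g\<^sup>2 + m\<^sup>2)"
  \<comment> \<open>The height \<open>w\<close> lifts \<open>(x, y)\<close> to the unit sphere;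
    \<open>(x, w)\<close> is then rotated to \<open>(s, t)\<close> so that
    \<open>a * s + b * t = x\<close>.\<close>
  define w where "w = sqrt (1 - x\<^sup>2 - y\<^sup>2)"
  define s where "s = a * x - b * w"
  define t where "t = b * x + a * w"
  have w: "w\<^sup>2 = 1 - x\<^sup>2 - y\<^sup>2" using xy by (simp add: w_def)
  have "s\<^sup>2 + t\<^sup>2 = (a\<^sup>2 + b\<^sup>2) * (x\<^sup>2 + w\<^sup>2)"
    unfolding s_def t_def by algebra
  then have "s\<^sup>2 + (cmod (u * Complex t y))\<^sup>2 = 1"
    using ab(3) w by (simp add: norm_mult u cmod_power2)
  moreover have "g * s + m * t = r * x"
  proof -
    have "g * s + m * t = r * (a\<^sup>2 + b\<^sup>2) * x"
      using ab(1,2) unfolding r_def[symmetric] s_def t_def by algebra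
    then show ?thesis by (simp add: ab(3))
  qed
  then have "of_real g * of_real s + of_real m * Complex t y = Complex (r * x) (m * y)"
    by (simp add: complex_eq_iff)
  then have "of_real g * u * of_real s + of_real m * (u * Complex t y) = u * Complex (r * x) (m * y)"
    by (metis (no_types, lifting) distrib_left mult.assoc mult.commute)
  ultimately show ?thesis unfolding r_def by blast
qed

theorem theorem3:
  fixes \<alpha> \<beta> \<gamma> :: complex
    and \<mu> \<phi> :: real
    and C :: "complex ^ 'k ^ 'm"
    and D :: "complex ^ 'm ^ 'k"
    and A :: "complex ^ ('m + 'k) ^ ('m + 'k)"
    and H Z :: "complex ^ 'k ^ 'k"
    and L :: "(complex ^ 'k) set"
  assumes A: "A = block_matrix (mat \<alpha>) C D (mat \<beta>)"
    and H: "H = conj_transpose C ** C + D ** conj_transpose D"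
    and Z: "Z = D ** C"
    and L_subspace: "vec.subspace L"
    and L_invariant: "\<forall>x\<in>L. H *v x \<in> L"
    and range_Z: "range (\<lambda>x. Z *v x) \<subseteq> L"
    and L_kernel: "L \<subseteq> {x. Z *v x = 0}"
    and \<mu>: "\<mu> = largest_eigenvalue (H - 2 *\<^sub>R re_part Z)"
    and \<gamma>: "\<gamma> = (\<alpha> - \<beta>) / 2"
    and \<phi>: "\<phi> = Arg (cnj \<gamma>)"
  shows "is_elliptical_disk (numerical_range A) ((\<alpha> + \<beta>) / 2) (cis (- \<phi>))
           (sqrt (\<mu> + 4 * (cmod \<gamma>)\<^sup>2)) (sqrt \<mu>)"
proof -
  define u where "u = cis (- \<phi>)"
  define m where "m = sqrt \<mu> / 2"
  have u: "cmod u = 1" by (simp add: u_def)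
  \<comment> \<open>The conjugate inside \<open>Arg\<close> and the sign in
    \<open>cis (- \<phi>)\<close> cancel, so \<open>u\<close> points along \<gamma>; for
    \<open>\<gamma> = 0\<close> both sides are zero.\<close>
  have \<gamma>u: "of_real (cmod \<gamma>) * u = \<gamma>"
  proof -
    have "cnj \<gamma> = of_real (cmod \<gamma>) * cis \<phi>"
      using rcis_cmod_Arg[of "cnj \<gamma>"] by (simp add: \<phi> rcis_def)
    then have "cnj (cnj \<gamma>) = cnj (of_real (cmod \<gamma>) * cis \<phi>)" by simp
    then show ?thesis by (simp add: u_def cis_cnj)
  qed
  note off = offdiagonal_range[OF L_subspace L_invariant[unfolded H] range_Z[unfolded Z]
      L_kernel[unfolded Z], folded H Z, folded \<mu>]
  have \<mu>0: "0 \<le> \<mu>" by (rule off(1))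
  have m: "0 \<le> m" "2 * m = sqrt \<mu>" "sqrt \<mu> / 2 = m" using \<mu>0 by (simp_all add: m_def)
  have "(2 * sqrt ((cmod \<gamma>)\<^sup>2 + m\<^sup>2))\<^sup>2 = \<mu> + 4 * (cmod \<gamma>)\<^sup>2"
    using \<mu>0 by (simp add: m_def power_mult_distrib power_divide)
  then have "sqrt (\<mu> + 4 * (cmod \<gamma>)\<^sup>2) = 2 * sqrt ((cmod \<gamma>)\<^sup>2 + m\<^sup>2)"
    by (intro real_sqrt_unique) auto
  then have r: "sqrt (\<mu> + 4 * (cmod \<gamma>)\<^sup>2) / 2 = sqrt ((cmod \<gamma>)\<^sup>2 + m\<^sup>2)" by simp
  \<comment> \<open>The numerical range is squeezed between the images of the sphere and of the ball
    under one real-linear map, shifted to the center; both images are the ellipse.\<close>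
  have sub: "numerical_range A
      \<subseteq> {(\<alpha> + \<beta>) / 2 + \<gamma> * of_real s + of_real m * z | s z. s\<^sup>2 + (cmod z)\<^sup>2 \<le> 1}"
    unfolding A \<gamma> using off(2) by (intro numerical_range_block_subset m(1)) (simp add: m(2))
  have sup: "(\<alpha> + \<beta>) / 2 + \<gamma> * of_real s + of_real m * z \<in> numerical_range A"
    if "s\<^sup>2 + (cmod z)\<^sup>2 = 1" for s z
    unfolding A \<gamma> using off(3) that by (intro numerical_range_block_superset) (simp_all only: m(2))
  have "numerical_range A = {(\<alpha> + \<beta>) / 2 +
      u * Complex (sqrt ((cmod \<gamma>)\<^sup>2 + m\<^sup>2) * x) (m * y) | x y. x\<^sup>2 + y\<^sup>2 \<le> 1}"
    (is "_ = ?E")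
  proof (intro equalityI subsetI)
    fix w assume "w \<in> numerical_range A"
    then obtain s z where "s\<^sup>2 + (cmod z)\<^sup>2 \<le> 1"
      and "w = (\<alpha> + \<beta>) / 2 + \<gamma> * of_real s + of_real m * z"
      using sub by blast
    then show "w \<in> ?E"
      using ball_image_subset_ellipse[OF u, of s z "cmod \<gamma>" m] unfolding \<gamma>u
      by (auto simp: add.assoc)
  next
    fix w assume "w \<in> ?E"
    then obtain x y where "x\<^sup>2 + y\<^sup>2 \<le> 1"
      and w: "w = (\<alpha> + \<beta>) / 2 + u * Complex (sqrt ((cmod \<gamma>)\<^sup>2 + m\<^sup>2) * x) (m * y)"
      by blast
    then obtain s z where "s\<^sup>2 + (cmod z)\<^sup>2 = 1"
      and "\<gamma> * of_real s + of_real m * z = u * Complex (sqrt ((cmod \<gamma>)\<^sup>2 + m\<^sup>2) * x) (m * y)"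
      using ellipse_subset_sphere_image[OF u, of x y "cmod \<gamma>" m] unfolding \<gamma>u by blast
    with sup[of s z] show "w \<in> numerical_range A" by (simp add: w add.assoc)
  qed
  moreover have "sqrt \<mu> \<le> sqrt (\<mu> + 4 * (cmod \<gamma>)\<^sup>2)" by simp
  ultimately show ?thesis
    unfolding is_elliptical_disk_def r m(3) u_def[symmetric] using u \<mu>0 by simp
qed

end
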